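(* Let $A$ be a proper subset of a set $D$ such that $a\in A$ and $0\in A$. Define binary operations on $D$ by $$x\dashv y=\begin{cases}x,&\text{if } x\in A,\\ a,&\text{if } x\in D\setminus A,\end{cases}\qquad x\vdash y=0\ \text{ for all } x,y\in D.$$ Then $(D,\dashv,\vdash)$ is a rectangular dimonoid with empty halo and $\mathrm{Aut}(D,\dashv,\vdash)\cong S_{A\setminus\{0,a\}}\times S_{D\setminus A}$. Moreover, if $|A|>1$, then $(D,\dashv,\vdash)$ is a nonabelian noncommutative dimonoid.
   Context: A dimonoid is a set $D$ with two associative binary operations $\dashv,\vdash$ satisfying, for all $x,y,z\in D$: $(D_1)$ $(x\dashv y)\dashv z=x\dashv(y\vdash z)$; $(D_2)$ $(x\vdash y)\dashv z=x\vdash(y\dashv z)$; $(D_3)$ $(x\dashv y)\vdash z=x\vdash(y\vdash z)$. A dimonoid is commutative if both $\dashv$ and $\vdash$ are commutative (noncommutative means not commutative). It is abelian if $x\dashv y=y\vdash x$ for all $x,y$ (nonabelian means not abelian). It is rectangular if both semigroups $(D,\dashv)$ and $(D,\vdash)$ are rectangular, where a semigroup $(S,* )$ is rectangular if $x*y*z=x*z$ for all $x,y,z\in S$. The halo of a dimonoid is the set of its bar-units, i.e. elements $e$ with $e\vdash d=d=d\dashv e$ for all $d\in D$. $\mathrm{Aut}(D,\dashv,\vdash)$ is the group of bijections $D\to D$ preserving both operations. The elements $a$ and $0$ of $A$ are allowed to coincide. $S_X$ denotes the group of all permutations of the set $X$ (the trivial group if $X=\emptyset$). *)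

theory Defs
  imports "HOL-Algebra.Bij"
begin

text \<open>
  Semigroups and dimonoids are given by a carrier set and binary operations on the ambient type,
  whose values outside the carrier are irrelevant.
\<close>

locale semigroup_on =
  fixes S :: "'a set" and f :: "'a \<Rightarrow> 'a \<Rightarrow> 'a"
  assumes closed: "\<lbrakk>x \<in> S; y \<in> S\<rbrakk> \<Longrightarrow> f x y \<in> S"
    and assoc: "\<lbrakk>x \<in> S; y \<in> S; z \<in> S\<rbrakk> \<Longrightarrow> f (f x y) z = f x (f y z)"

definition rectangular_semigroup :: "'a set \<Rightarrow> ('a \<Rightarrow> 'a \<Rightarrow> 'a) \<Rightarrow> bool" where
  "rectangular_semigroup S f \<longleftrightarrow>
     semigroup_on S f \<and> (\<forall>x\<in>S. \<forall>y\<in>S. \<forall>z\<in>S. f (f x y) z = f x z)"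

definition commutative_on :: "'a set \<Rightarrow> ('a \<Rightarrow> 'a \<Rightarrow> 'a) \<Rightarrow> bool" where
  "commutative_on S f \<longleftrightarrow> (\<forall>x\<in>S. \<forall>y\<in>S. f x y = f y x)"

locale dimonoid =
  left: semigroup_on D l + right: semigroup_on D r
  for D :: "'a set"
    and l :: "'a \<Rightarrow> 'a \<Rightarrow> 'a"  (infixl \<open>\<stileturn>\<close> 70)
    and r :: "'a \<Rightarrow> 'a \<Rightarrow> 'a"  (infixl \<open>\<turnstile>\<close> 70) +
  assumes D1: "\<lbrakk>x \<in> D; y \<in> D; z \<in> D\<rbrakk> \<Longrightarrow> (x \<stileturn> y) \<stileturn> z = x \<stileturn> (y \<turnstile> z)"
    and D2: "\<lbrakk>x \<in> D; y \<in> D; z \<in> D\<rbrakk> \<Longrightarrow> (x \<turnstile> y) \<stileturn> z = x \<turnstile> (y \<stileturn> z)"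
    and D3: "\<lbrakk>x \<in> D; y \<in> D; z \<in> D\<rbrakk> \<Longrightarrow> (x \<stileturn> y) \<turnstile> z = x \<turnstile> (y \<turnstile> z)"

definition commutative_dimonoid ::
    "'a set \<Rightarrow> ('a \<Rightarrow> 'a \<Rightarrow> 'a) \<Rightarrow> ('a \<Rightarrow> 'a \<Rightarrow> 'a) \<Rightarrow> bool" where
  "commutative_dimonoid D l r \<longleftrightarrow>
     dimonoid D l r \<and> commutative_on D l \<and> commutative_on D r"

definition abelian_dimonoid ::
    "'a set \<Rightarrow> ('a \<Rightarrow> 'a \<Rightarrow> 'a) \<Rightarrow> ('a \<Rightarrow> 'a \<Rightarrow> 'a) \<Rightarrow> bool" where
  "abelian_dimonoid D l r \<longleftrightarrow> dimonoid D l r \<and> (\<forall>x\<in>D. \<forall>y\<in>D. l x y = r y x)"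

definition rectangular_dimonoid ::
    "'a set \<Rightarrow> ('a \<Rightarrow> 'a \<Rightarrow> 'a) \<Rightarrow> ('a \<Rightarrow> 'a \<Rightarrow> 'a) \<Rightarrow> bool" where
  "rectangular_dimonoid D l r \<longleftrightarrow>
     dimonoid D l r \<and> rectangular_semigroup D l \<and> rectangular_semigroup D r"

definition halo ::
    "'a set \<Rightarrow> ('a \<Rightarrow> 'a \<Rightarrow> 'a) \<Rightarrow> ('a \<Rightarrow> 'a \<Rightarrow> 'a) \<Rightarrow> 'a set" where
  "halo D l r = {e \<in> D. \<forall>d\<in>D. r e d = d \<and> l d e = d}"

text \<open>
  As for \<^const>\<open>AutoGroup\<close>, automorphisms are taken as functions that are undefined outside the
  carrier, so that there is exactly one function per bijection of the carrier.  Likewise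
  \<^term>\<open>BijGroup X\<close> is the group of all permutations of \<^term>\<open>X\<close>.
\<close>

definition dimonoid_auto ::
    "'a set \<Rightarrow> ('a \<Rightarrow> 'a \<Rightarrow> 'a) \<Rightarrow> ('a \<Rightarrow> 'a \<Rightarrow> 'a) \<Rightarrow> ('a \<Rightarrow> 'a) set" where
  "dimonoid_auto D l r =
     {h \<in> Bij D. \<forall>x\<in>D. \<forall>y\<in>D. h (l x y) = l (h x) (h y) \<and> h (r x y) = r (h x) (h y)}"

definition dimonoid_Aut ::
    "'a set \<Rightarrow> ('a \<Rightarrow> 'a \<Rightarrow> 'a) \<Rightarrow> ('a \<Rightarrow> 'a \<Rightarrow> 'a) \<Rightarrow> ('a \<Rightarrow> 'a) monoid" where
  "dimonoid_Aut D l r = BijGroup D \<lparr>carrier := dimonoid_auto D l r\<rparr>"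

lemma (in dimonoid) subgroup_dimonoid_auto: "subgroup (dimonoid_auto D l r) (BijGroup D)"
proof (rule group.subgroupI)
  show "group (BijGroup D)" by (rule group_BijGroup)
  show "dimonoid_auto D l r \<subseteq> carrier (BijGroup D)"
    by (auto simp: dimonoid_auto_def BijGroup_def)
  have "(\<lambda>x\<in>D. x) \<in> dimonoid_auto D l r"
    using left.closed right.closed by (auto simp: dimonoid_auto_def id_Bij)
  then show "dimonoid_auto D l r \<noteq> {}" by blast
next
  fix h assume "h \<in> dimonoid_auto D l r"
  then have h: "h \<in> Bij D"
    and hl: "\<And>x y. x \<in> D \<Longrightarrow> y \<in> D \<Longrightarrow> h (x \<stileturn> y) = h x \<stileturn> h y"
    and hr: "\<And>x y. x \<in> D \<Longrightarrow> y \<in> D \<Longrightarrow> h (x \<turnstile> y) = h x \<turnstile> h y"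
    by (auto simp: dimonoid_auto_def)
  then show "inv\<^bsub>BijGroup D\<^esub> h \<in> dimonoid_auto D l r"
    using left.closed right.closed Bij_inv_into_lemma[OF _ h, of l] Bij_inv_into_lemma[OF _ h, of r]
    by (auto simp: dimonoid_auto_def inv_BijGroup restrict_inv_into_Bij)
next
  fix g h assume gh: "g \<in> dimonoid_auto D l r" "h \<in> dimonoid_auto D l r"
  then have "g \<in> Bij D" "h \<in> Bij D" by (auto simp: dimonoid_auto_def)
  moreover from this have "\<And>x. x \<in> D \<Longrightarrow> h x \<in> D" using Bij_imp_funcset by blast
  ultimately show "g \<otimes>\<^bsub>BijGroup D\<^esub> h \<in> dimonoid_auto D l r"
    using gh left.closed right.closed
    by (auto simp: dimonoid_auto_def BijGroup_def compose_Bij compose_eq)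
qed

lemma (in dimonoid) group_dimonoid_Aut: "group (dimonoid_Aut D l r)"
  unfolding dimonoid_Aut_def
  by (rule subgroup.subgroup_is_group[OF subgroup_dimonoid_auto group_BijGroup])

end

theory Submission
  imports Defs
begin

text \<open>
  An automorphism \<open>h\<close> fixes \<open>z\<close>, the only value of \<open>\<turnstile>\<close>.  Reading off \<open>h (x \<stileturn> x) = h x \<stileturn> h x\<close>, it maps
  \<open>A\<close> into \<open>A\<close> and, since \<open>h a = h x\<close> is impossible for \<open>x \<notin> A\<close>, it fixes \<open>a\<close> and maps \<open>D - A\<close> into
  \<open>D - A\<close>.  Conversely every such permutation is an automorphism, and it is determined by its
  restrictions to \<open>A - {z, a}\<close> and \<open>D - A\<close>, which are arbitrary permutations.
\<close>

lemma restrict_Bij: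
  assumes "inj_on h D" and "B \<subseteq> D" and "h ` B = B"
  shows "restrict h B \<in> Bij B"
proof -
  have "bij_betw h B B"
    using assms by (auto simp: bij_betw_def intro: inj_on_subset)
  then show ?thesis
    by (simp add: Bij_def cong: bij_betw_cong)
qed

text \<open>A permutation in \<open>H\<close> is glued from its restrictions to \<open>B\<close> and
  \<open>C\<close> and the identity elsewhere, so restricting to both sets loses nothing.
  \<open>H\<close> enters through an equation so that the automorphism set can be substituted for
  it.\<close>

lemma iso_BijGroup_DirProd:
  assumes BC: "B \<subseteq> D" "C \<subseteq> D" "B \<inter> C = {}"
    and H: "H = {h \<in> Bij D. h ` B = B \<and> h ` C = C \<and> (\<forall>x\<in>D - (B \<union> C). h x = x)}"
  shows "BijGroup D \<lparr>carrier := H\<rparr> \<cong> BijGroup B \<times>\<times> BijGroup C"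
proof -
  let ?\<phi> = "\<lambda>h. (restrict h B, restrict h C)"
  have HD: "h \<in> Bij D" "inj_on h D" "h \<in> extensional D" if "h \<in> H" for h
    using that by (auto simp: H Bij_def bij_betw_def)
  have imH: "h ` B = B" "h ` C = C" if "h \<in> H" for h
    using that by (simp_all add: H)
  have HB: "h x \<in> B" if "h \<in> H" "x \<in> B" for h x
    using that by (auto simp: H)
  have HC: "h x \<in> C" if "h \<in> H" "x \<in> C" for h x
    using that by (auto simp: H)
  have res: "restrict h B \<in> Bij B" "restrict h C \<in> Bij C" if "h \<in> H" for h
    using restrict_Bij[OF HD(2) BC(1)] restrict_Bij[OF HD(2) BC(2)] that imH by simp_all
  have hom: "?\<phi> \<in> hom (BijGroup D \<lparr>carrier := H\<rparr>) (BijGroup B \<times>\<times> BijGroup C)"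
  proof (rule homI)
    fix h assume "h \<in> carrier (BijGroup D \<lparr>carrier := H\<rparr>)"
    then show "?\<phi> h \<in> carrier (BijGroup B \<times>\<times> BijGroup C)"
      using res by (simp add: BijGroup_def)
  next
    fix g h assume "g \<in> carrier (BijGroup D \<lparr>carrier := H\<rparr>)" "h \<in> carrier (BijGroup D \<lparr>carrier := H\<rparr>)"
    then have gh: "g \<in> H" "h \<in> H" by auto
    have "restrict (compose D g h) B = compose B (restrict g B) (restrict h B)"
      using BC HB[OF gh(2)] by (auto simp: compose_def restrict_def fun_eq_iff)
    moreover have "restrict (compose D g h) C = compose C (restrict g C) (restrict h C)"
      using BC HC[OF gh(2)] by (auto simp: compose_def restrict_def fun_eq_iff)
    ultimately show "?\<phi> (g \<otimes>\<^bsub>BijGroup D \<lparr>carrier := H\<rparr>\<^esub> h)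
        = ?\<phi> g \<otimes>\<^bsub>BijGroup B \<times>\<times> BijGroup C\<^esub> ?\<phi> h"
      using gh HD res by (simp add: BijGroup_def)
  qed
  have inj: "inj_on ?\<phi> H"
  proof (rule inj_onI)
    fix g h assume gh: "g \<in> H" "h \<in> H" and eq: "?\<phi> g = ?\<phi> h"
    show "g = h"
    proof (rule extensionalityI)
      fix x assume "x \<in> D"
      then consider "x \<in> B" | "x \<in> C" | "x \<in> D - (B \<union> C)" by blast
      then show "g x = h x"
        using eq gh by cases (auto simp: H dest: fun_cong[of _ _ x])
    qed (use gh HD in auto)
  qed
  have surj: "(f, g) \<in> ?\<phi> ` H" if f: "f \<in> Bij B" and g: "g \<in> Bij C" for f g
  proof -
    \<comment> \<open>The preimage of \<open>(f, g)\<close>: disjointness of \<open>B\<close> and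
      \<open>C\<close> makes the order of the cases harmless, and restricting to \<open>D\<close>
      makes \<open>h\<close> extensional, as \<open>Bij\<close> demands.\<close>
    define h where "h = (\<lambda>x\<in>D. if x \<in> B then f x else if x \<in> C then g x else x)"
    have fB: "bij_betw f B B" and gC: "bij_betw g C C"
      and ext: "f \<in> extensional B" "g \<in> extensional C"
      using f g by (auto simp: Bij_def)
    have hB: "bij_betw h B B"
      using fB BC by (subst bij_betw_cong[of _ _ f]) (auto simp: h_def)
    moreover have hC: "bij_betw h C C"
      using gC BC by (subst bij_betw_cong[of _ _ g]) (auto simp: h_def)
    moreover have "bij_betw h (D - (B \<union> C)) (D - (B \<union> C))"
      by (subst bij_betw_cong[of _ _ id]) (auto simp: h_def)
    ultimately have "bij_betw h (B \<union> C \<union> (D - (B \<union> C))) (B \<union> C \<union> (D - (B \<union> C)))"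
      using BC by (intro bij_betw_combine) auto
    moreover have "B \<union> C \<union> (D - (B \<union> C)) = D"
      using BC by blast
    ultimately have "h \<in> H"
      using hB hC by (auto simp: H Bij_def bij_betw_def h_def)
    moreover have "restrict h B = f"
      by (rule extensionalityI) (use BC ext in \<open>auto simp: h_def\<close>)
    moreover have "restrict h C = g"
      by (rule extensionalityI) (use BC ext in \<open>auto simp: h_def\<close>)
    ultimately show ?thesis by force
  qed
  have "?\<phi> ` H = Bij B \<times> Bij C"
    using hom surj by (auto simp: hom_def BijGroup_def)
  then have "?\<phi> \<in> iso (BijGroup D \<lparr>carrier := H\<rparr>) (BijGroup B \<times>\<times> BijGroup C)"
    using hom inj by (simp add: iso_def bij_betw_def BijGroup_def)
  then show ?thesis by (rule is_isoI)
qed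

theorem theorem3p7:
  fixes D A :: "'a set" and a z :: 'a
    and l :: "'a \<Rightarrow> 'a \<Rightarrow> 'a"  (infixl \<open>\<stileturn>\<close> 70)
    and r :: "'a \<Rightarrow> 'a \<Rightarrow> 'a"  (infixl \<open>\<turnstile>\<close> 70)
  assumes "A \<subset> D" and "a \<in> A" and "z \<in> A"
    and "\<And>x y. x \<in> D \<Longrightarrow> y \<in> D \<Longrightarrow> x \<stileturn> y = (if x \<in> A then x else a)"
    and "\<And>x y. x \<in> D \<Longrightarrow> y \<in> D \<Longrightarrow> x \<turnstile> y = z"
  shows "rectangular_dimonoid D l r
    \<and> halo D l r = {}
    \<and> dimonoid_Aut D l r \<cong> BijGroup (A - {z, a}) \<times>\<times> BijGroup (D - A)
    \<and> ((infinite A \<or> card A > 1) \<longrightarrow>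
         dimonoid D l r \<and> \<not> abelian_dimonoid D l r \<and> \<not> commutative_dimonoid D l r)"
proof -
  note l = assms(4) and r = assms(5)
  have AD: "x \<in> D" if "x \<in> A" for x
    using assms(1) that by blast
  have aD: "a \<in> D" and zD: "z \<in> D"
    using AD assms(2,3) by auto
  obtain b where b: "b \<in> D" "b \<notin> A"
    using assms(1) by blast
  have semi: "semigroup_on D l" "semigroup_on D r"
    using aD zD assms(2,3) by (auto simp: semigroup_on_def l r)
  \<comment> \<open>\<open>a \<in> A\<close> gives \<open>D1\<close>, because
    \<open>a \<stileturn> y = a\<close>; \<open>z \<in> A\<close> gives \<open>D2\<close>, because
    \<open>z \<stileturn> y = z\<close>. Both sides of \<open>D3\<close> are
    \<open>z\<close>.\<close>
  have dim: "dimonoid D l r"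
    using semi aD zD assms(2,3) by (auto simp: dimonoid_def dimonoid_axioms_def l r)
  have rect: "rectangular_dimonoid D l r"
    using dim semi aD zD assms(2,3)
    by (auto simp: rectangular_dimonoid_def rectangular_semigroup_def l r)
  \<comment> \<open>A bar-unit \<open>e\<close> would give \<open>b = e \<turnstile> b = z\<close>,
    but \<open>b\<close> lies outside \<open>A\<close>.\<close>
  have halo: "halo D l r = {}"
    using b assms(3) by (auto simp: halo_def r intro!: bexI[of _ b])
  \<comment> \<open>This is the shape of \<open>H\<close> above; the points left over for
    \<open>h\<close> to fix are just \<open>z\<close> and \<open>a\<close>.\<close>
  have Aut: "dimonoid_auto D l r = {h \<in> Bij D. h ` (A - {z, a}) = A - {z, a} \<and> h ` (D - A) = D - A
      \<and> (\<forall>x\<in>D - (A - {z, a} \<union> (D - A)). h x = x)}" (is "_ = ?H")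
  proof (intro equalityI subsetI)
    fix h assume h: "h \<in> dimonoid_auto D l r"
    then have hD: "h ` D = D" and inj: "inj_on h D"
      and hl: "\<And>x y. x \<in> D \<Longrightarrow> y \<in> D \<Longrightarrow> h (x \<stileturn> y) = h x \<stileturn> h y"
      and hr: "\<And>x y. x \<in> D \<Longrightarrow> y \<in> D \<Longrightarrow> h (x \<turnstile> y) = h x \<turnstile> h y"
      by (auto simp: dimonoid_auto_def Bij_def bij_betw_def)
    have mem: "h x \<in> D" if "x \<in> D" for x
      using hD that by blast
    have hz: "h z = z"
      using hr[OF zD zD] zD mem by (simp add: r)
    \<comment> \<open>Here \<open>x \<stileturn> x = x\<close>, so
      \<open>h x = h x \<stileturn> h x\<close>, and every value of \<open>\<stileturn>\<close> lies
      in \<open>A\<close>.\<close>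
    have hA: "h x \<in> A" if "x \<in> A" for x
      using hl[of x x] that AD mem assms(2) by (auto simp: l split: if_splits)
    \<comment> \<open>Now \<open>x \<stileturn> x = a\<close>, so
      \<open>h a = h x \<stileturn> h x\<close>. If \<open>h x\<close> were in \<open>A\<close>,
      this would be \<open>h x\<close>, against injectivity; hence it is \<open>a\<close>. That
      \<open>h a = a\<close> thus needs a point outside \<open>A\<close>, which \<open>b\<close>
      supplies.\<close>
    have hC: "h x \<notin> A \<and> h a = a" if "x \<in> D" "x \<notin> A" for x
    proof -
      have "h a \<noteq> h x"
        using inj aD that assms(2) by (auto dest: inj_onD)
      then show ?thesis
        using hl[of x x] that mem by (auto simp: l split: if_splits)
    qed
    then have ha: "h a = a"
      using b by blast
    have imC: "h ` (D - A) = D - A"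
    proof
      show "D - A \<subseteq> h ` (D - A)"
      proof
        fix y assume y: "y \<in> D - A"
        then obtain x where "x \<in> D" "y = h x"
          using hD by blast
        then show "y \<in> h ` (D - A)"
          using y hA by blast
      qed
    qed (use hC mem in auto)
    have imB: "h ` (A - {z, a}) = A - {z, a}"
    proof (intro equalityI subsetI)
      fix y assume "y \<in> h ` (A - {z, a})"
      then obtain x where x: "x \<in> A" "x \<noteq> z" "x \<noteq> a" "y = h x"
        by blast
      then have "h x \<noteq> h z" "h x \<noteq> h a"
        using inj_on_eq_iff[OF inj] AD zD aD by auto
      then show "y \<in> A - {z, a}"
        using x hA hz ha by auto
    next
      fix y assume y: "y \<in> A - {z, a}"
      then obtain x where x: "x \<in> D" "y = h x"
        using hD AD by blast
      then show "y \<in> h ` (A - {z, a})"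
        using y hC hz ha by blast
    qed
    show "h \<in> ?H"
      using h imB imC hz ha by (auto simp: dimonoid_auto_def)
  next
    fix h assume "h \<in> ?H"
    then have h: "h \<in> Bij D" and imB: "h ` (A - {z, a}) = A - {z, a}"
      and imC: "h ` (D - A) = D - A" and fixed: "h z = z" "h a = a"
      using aD zD assms(2,3) by auto
    have mem: "h x \<in> D" if "x \<in> D" for x
      using h that Bij_imp_funcset by blast
    \<comment> \<open>With this equivalence \<open>h\<close> respects the case distinction defining
      \<open>\<stileturn>\<close>; \<open>h a = a\<close> and \<open>h z = z\<close> settle the
      constant values.\<close>
    have "h x \<in> A \<longleftrightarrow> x \<in> A" if "x \<in> D" for x
    proof
      show "h x \<in> A" if "x \<in> A"
        using imB fixed assms(2,3) that by (metis DiffD1 DiffI imageI insertE singletonD)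
      show "x \<in> A" if "h x \<in> A"
        using imC \<open>x \<in> D\<close> that by blast
    qed
    then show "h \<in> dimonoid_auto D l r"
      using h mem fixed by (auto simp: dimonoid_auto_def l r)
  qed
  have iso: "dimonoid_Aut D l r \<cong> BijGroup (A - {z, a}) \<times>\<times> BijGroup (D - A)"
    unfolding dimonoid_Aut_def
    by (rule iso_BijGroup_DirProd[OF _ _ _ Aut]) (use AD in auto)
  have non: "\<not> abelian_dimonoid D l r \<and> \<not> commutative_dimonoid D l r"
    if "infinite A \<or> card A > 1"
  proof -
    \<comment> \<open>A second element \<open>c\<close> of \<open>A\<close> separates the products:
      \<open>c \<stileturn> z = c\<close>, while \<open>z \<turnstile> c\<close> and
      \<open>z \<stileturn> c\<close> are both \<open>z\<close>.\<close>
    have "A \<noteq> {z}"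
      using that by auto
    then obtain c where c: "c \<in> A" "c \<noteq> z"
      using assms(3) by blast
    then have "c \<stileturn> z \<noteq> z \<turnstile> c" "c \<stileturn> z \<noteq> z \<stileturn> c"
      using AD zD assms(3) by (auto simp: l r)
    then show ?thesis
      using c AD zD by (auto simp: abelian_dimonoid_def commutative_dimonoid_def commutative_on_def)
  qed
  show ?thesis
    using rect halo iso dim non by blast
qed

end
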